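(* Let $\mathrm{uCom}$ be the terminal single-coloured symmetric operad in sets, the operad of commutative monoids. The categories $\mathrm{Tw}_{\mathrm{sOp}}(\mathrm{uCom})$ and $\mathcal U_{\mathrm{sOp}}(\mathrm{uCom})$ are isomorphic to Segal's category $\Gamma=sk(\mathrm{FinSet}_*^{op})$, the skeleton of the opposite category of the category of finite pointed sets.
   Context: For a single-coloured symmetric operad $P$ in sets the category $\mathrm{Tw}_{\mathrm{sOp}}(P)$ is the following one. Objects: operations of $P$. A morphism with source $p$ of arity $n$ is (uniquely) a tuple $f=(q_0;q_1,\dots,q_n;\lambda)$, where $q_i\in P$ has arity $m_i$, $m_0\ge1$, and $\lambda$ is a bijection from the set of leaves $\{(i,k):1\le i\le n,1\le k\le m_i\}\cup\{(0,k):2\le k\le m_0\}$ onto $\{1,\dots,N\}$ with $k\mapsto\lambda(i,k)$ increasing for each fixed $i$. The target is the operation $t$ with $t(x_1,\dots,x_N)=q_0\bigl(p(q_1(x_{\lambda(1,1)},\dots,x_{\lambda(1,m_1)}),\dots,q_n(x_{\lambda(n,1)},\dots)),x_{\lambda(0,2)},\dots,x_{\lambda(0,m_0)}\bigr)$. The composite of $f:p\to t$ with $g=(r_0;r_1,\dots,r_N;\mu):t\to u$ has upper vertices $q_i(r_{\lambda(i,1)},\dots,r_{\lambda(i,m_i)})$ and lower vertex $r_0\circ_1 q_0(\mathrm{id},r_{\lambda(0,2)},\dots,r_{\lambda(0,m_0)})$, with leaves numbered by $\mu$, and with inputs of each vertex (other than the first input of the lower one) then permuted so that the numbers increase. The enveloping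 category $\mathcal U_{\mathrm{sOp}}(P)$ has natural numbers (arities) as objects and the same tuples as morphisms, with the source vertex of arity $n$ being unmarked; the target is the resulting arity $N$. The operad $\mathrm{uCom}$ has exactly one operation of each arity $n\ge0$. *)

theory Defs
  imports "HOL-Library.FuncSet" "HOL-Combinatorics.Permutations"
begin

section \<open>Categories\<close>

text \<open>Categories given by hom-sets. Since hom-sets need not be disjoint, composition takes the
  three objects as arguments: \<open>Comp C a b c g f\<close> is the composite of
  \<open>f \<in> Hom C a b\<close> followed by \<open>g \<in> Hom C b c\<close>.\<close>

record ('o, 'm) cat =
  Obj :: "'o set"
  Hom :: "'o \<Rightarrow> 'o \<Rightarrow> 'm set"
  Id :: "'o \<Rightarrow> 'm"
  Comp :: "'o \<Rightarrow> 'o \<Rightarrow> 'o \<Rightarrow> 'm \<Rightarrow> 'm \<Rightarrow> 'm"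

definition category :: "('o, 'm) cat \<Rightarrow> bool" where
  "category C \<longleftrightarrow>
    (\<forall>a\<in>Obj C. Id C a \<in> Hom C a a) \<and>
    (\<forall>a\<in>Obj C. \<forall>b\<in>Obj C. \<forall>c\<in>Obj C. \<forall>f\<in>Hom C a b. \<forall>g\<in>Hom C b c. Comp C a b c g f \<in> Hom C a c) \<and>
    (\<forall>a\<in>Obj C. \<forall>b\<in>Obj C. \<forall>f\<in>Hom C a b. Comp C a a b f (Id C a) = f \<and> Comp C a b b (Id C b) f = f) \<and>
    (\<forall>a\<in>Obj C. \<forall>b\<in>Obj C. \<forall>c\<in>Obj C. \<forall>d\<in>Obj C. \<forall>f\<in>Hom C a b. \<forall>g\<in>Hom C b c. \<forall>h\<in>Hom C c d.
        Comp C a c d h (Comp C a b c g f) = Comp C a b d (Comp C b c d h g) f)"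

definition is_functor ::
  "('o, 'm) cat \<Rightarrow> ('p, 'n) cat \<Rightarrow> ('o \<Rightarrow> 'p) \<Rightarrow> ('o \<Rightarrow> 'o \<Rightarrow> 'm \<Rightarrow> 'n) \<Rightarrow> bool" where
  "is_functor C D F0 F1 \<longleftrightarrow>
    (\<forall>a\<in>Obj C. F0 a \<in> Obj D) \<and>
    (\<forall>a\<in>Obj C. \<forall>b\<in>Obj C. \<forall>f\<in>Hom C a b. F1 a b f \<in> Hom D (F0 a) (F0 b)) \<and>
    (\<forall>a\<in>Obj C. F1 a a (Id C a) = Id D (F0 a)) \<and>
    (\<forall>a\<in>Obj C. \<forall>b\<in>Obj C. \<forall>c\<in>Obj C. \<forall>f\<in>Hom C a b. \<forall>g\<in>Hom C b c.
        F1 a c (Comp C a b c g f) = Comp D (F0 a) (F0 b) (F0 c) (F1 b c g) (F1 a b f))"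

text \<open>Isomorphism (not merely equivalence) of categories: a functor with a strict two-sided
  inverse.\<close>

definition isomorphic_categories :: "('o, 'm) cat \<Rightarrow> ('p, 'n) cat \<Rightarrow> bool" where
  "isomorphic_categories C D \<longleftrightarrow> category C \<and> category D \<and>
    (\<exists>F0 F1 G0 G1. is_functor C D F0 F1 \<and> is_functor D C G0 G1 \<and>
      (\<forall>a\<in>Obj C. G0 (F0 a) = a) \<and>
      (\<forall>a\<in>Obj C. \<forall>b\<in>Obj C. \<forall>f\<in>Hom C a b. G1 (F0 a) (F0 b) (F1 a b f) = f) \<and>
      (\<forall>x\<in>Obj D. F0 (G0 x) = x) \<and>
      (\<forall>x\<in>Obj D. \<forall>y\<in>Obj D. \<forall>h\<in>Hom D x y. F1 (G0 x) (G0 y) (G1 x y h) = h))"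

definition opposite :: "('o, 'm) cat \<Rightarrow> ('o, 'm) cat" where
  "opposite C = \<lparr>Obj = Obj C, Hom = (\<lambda>a b. Hom C b a), Id = Id C,
     Comp = (\<lambda>a b c g f. Comp C c b a f g)\<rparr>"

definition full_subcategory :: "('o, 'm) cat \<Rightarrow> 'o set \<Rightarrow> ('o, 'm) cat" where
  "full_subcategory C S = C\<lparr>Obj := S\<rparr>"

definition isomorphic_objects :: "('o, 'm) cat \<Rightarrow> 'o \<Rightarrow> 'o \<Rightarrow> bool" where
  "isomorphic_objects C a b \<longleftrightarrow>
    (\<exists>f\<in>Hom C a b. \<exists>g\<in>Hom C b a. Comp C a b a g f = Id C a \<and> Comp C b a b f g = Id C b)"

definition is_skeleton :: "('o, 'm) cat \<Rightarrow> ('o, 'm) cat \<Rightarrow> bool" where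
  "is_skeleton S C \<longleftrightarrow> Obj S \<subseteq> Obj C \<and> S = full_subcategory C (Obj S) \<and>
    (\<forall>a\<in>Obj C. \<exists>!s. s \<in> Obj S \<and> isomorphic_objects C a s)"


section \<open>Segal's category\<close>

text \<open>Finite pointed sets \<open>(A, a)\<close>, realised as sets of natural numbers, which contain every finite
  pointed set up to isomorphism.\<close>

definition FinSet_pt :: "(nat set \<times> nat, nat \<Rightarrow> nat) cat" where
  "FinSet_pt = \<lparr>Obj = {(A, a). finite A \<and> a \<in> A},
     Hom = (\<lambda>(A, a) (B, b). {f \<in> A \<rightarrow>\<^sub>E B. f a = b}),
     Id = (\<lambda>(A, a). restrict id A),
     Comp = (\<lambda>(A, a) _ _ g f. compose A g f)\<rparr>"

definition Gamma :: "(nat set \<times> nat, nat \<Rightarrow> nat) cat" where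
  "Gamma = full_subcategory (opposite FinSet_pt) (range (\<lambda>n. ({0..n}, 0)))"

lemma category_FinSet_pt: "category FinSet_pt"
  unfolding category_def FinSet_pt_def
  by (auto simp: compose_def PiE_def extensional_def fun_eq_iff Pi_def)

lemma isomorphic_objects_opposite_FinSet_pt:
  assumes "(A, a) \<in> Obj FinSet_pt" "(B, b) \<in> Obj FinSet_pt"
  shows "isomorphic_objects (opposite FinSet_pt) (A, a) (B, b) \<longleftrightarrow> card A = card B"
proof
  assume "isomorphic_objects (opposite FinSet_pt) (A, a) (B, b)"
  then obtain f g where fg: "f \<in> B \<rightarrow>\<^sub>E A" "g \<in> A \<rightarrow>\<^sub>E B"
    "compose A f g = restrict id A" "compose B g f = restrict id B"
    by (auto simp: isomorphic_objects_def opposite_def FinSet_pt_def)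
  have gf: "g (f y) = y" if "y \<in> B" for y
    using fun_cong[OF fg(4), of y] that by (simp add: compose_def)
  have fg': "f (g x) = x" if "x \<in> A" for x
    using fun_cong[OF fg(3), of x] that by (simp add: compose_def)
  have "bij_betw g A B"
    by (rule bij_betw_byWitness[where f' = f]) (use fg gf fg' in auto)
  then show "card A = card B" by (rule bij_betw_same_card)
next
  assume c: "card A = card B"
  from assms have fin: "finite A" "finite B" and pt: "a \<in> A" "b \<in> B"
    by (auto simp: FinSet_pt_def)
  from c fin pt have "card (A - {a}) = card (B - {b})" by simp
  then obtain h where h: "bij_betw h (A - {a}) (B - {b})"
    using fin by (metis bij_betw_iff_card finite_Diff)
  define g where "g = (\<lambda>x\<in>A. if x = a then b else h x)"
  have "bij_betw g (A - {a}) (B - {b})"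
    using h by (rule bij_betw_cong[THEN iffD1, rotated]) (auto simp: g_def)
  then have "bij_betw g ((A - {a}) \<union> {a}) ((B - {b}) \<union> {b})"
    by (rule bij_betw_combine) (auto simp: g_def pt)
  then have g: "bij_betw g A B"
    using pt by (simp add: insert_absorb)
  define f where "f = restrict (inv_into A g) B"
  have 1: "g \<in> A \<rightarrow>\<^sub>E B" "g a = b"
    using g pt by (auto simp: g_def dest: bij_betwE)
  have 2: "f \<in> B \<rightarrow>\<^sub>E A"
    using bij_betw_inv_into[OF g] by (auto simp: f_def dest: bij_betwE)
  have 3: "compose A f g = restrict id A" "compose B g f = restrict id B"
    using bij_betw_inv_into_left[OF g] bij_betw_inv_into_right[OF g] bij_betwE[OF g]
    by (auto simp: compose_def f_def fun_eq_iff)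
  have 4: "f b = a"
    using fun_cong[OF 3(1), of a] pt 1 by (simp add: compose_def)
  show "isomorphic_objects (opposite FinSet_pt) (A, a) (B, b)"
    unfolding isomorphic_objects_def
    by (rule bexI[of _ f], rule bexI[of _ g])
       (use 1 2 3 4 in \<open>auto simp: opposite_def FinSet_pt_def\<close>)
qed

lemma Gamma_is_skeleton: "is_skeleton Gamma (opposite FinSet_pt)"
proof -
  have sub: "({0..n}, 0) \<in> Obj FinSet_pt" for n :: nat
    by (simp add: FinSet_pt_def)
  have obj: "Obj Gamma = range (\<lambda>n. ({0..n}, 0))"
    by (simp add: Gamma_def full_subcategory_def)
  have ex: "\<exists>!s. s \<in> Obj Gamma \<and> isomorphic_objects (opposite FinSet_pt) x s"
    if x: "x \<in> Obj FinSet_pt" for x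
  proof -
    obtain A a where xA: "x = (A, a)" by (cases x)
    have c: "card A > 0" using x xA by (auto simp: FinSet_pt_def card_gt_0_iff)
    have iso: "isomorphic_objects (opposite FinSet_pt) x ({0..n}, 0) \<longleftrightarrow> n = card A - 1" for n
      using isomorphic_objects_opposite_FinSet_pt[OF x[unfolded xA] sub[of n]] c
      by (auto simp: xA)
    show ?thesis
      by (rule ex1I[of _ "({0..card A - 1}, 0)"]) (auto simp: obj iso)
  qed
  show ?thesis
    unfolding is_skeleton_def
    using ex sub by (auto simp: obj opposite_def Gamma_def full_subcategory_def)
qed


section \<open>Single-coloured symmetric operads in sets\<close>

text \<open>The sets \<open>P(n)\<close> are bundled into one set \<open>ops P\<close> with an arity function. \<open>act P \<sigma> p\<close> is the
  operation with \<open>(act P \<sigma> p)(x\<^sub>1, \<dots>, x\<^sub>n) = p(x\<^bsub>\<sigma> 1\<^esub>, \<dots>, x\<^bsub>\<sigma> n\<^esub>)\<close>: input \<open>k\<close> of \<open>p\<close> becomes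
  input \<open>\<sigma> k\<close>. This is a left action; the usual right action is that of the inverse of \<open>\<sigma>\<close>.
  Inputs are numbered from 1, while list positions start at 0.\<close>

record 'a operad =
  ops :: "'a set"
  arity :: "'a \<Rightarrow> nat"
  one :: "'a"
  gam :: "'a \<Rightarrow> 'a list \<Rightarrow> 'a"
  act :: "(nat \<Rightarrow> nat) \<Rightarrow> 'a \<Rightarrow> 'a"

definition offset :: "'a operad \<Rightarrow> 'a list \<Rightarrow> nat \<Rightarrow> nat" where
  "offset P qs i = sum_list (map (arity P) (take (i - 1) qs))"

text \<open>In the equivariance axioms, input \<open>k\<close> of the \<open>i\<close>-th operation of \<open>qs\<close> is
  input \<open>offset P qs i + k\<close> of \<open>gam P p qs\<close>. The hypotheses on \<open>\<tau>\<close> determine it as a block sum of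
  permutations, respectively as a permutation of blocks.\<close>

locale symmetric_operad =
  fixes P :: "'a operad"
  assumes one_ops: "one P \<in> ops P"
    and arity_one: "arity P (one P) = 1"
    and gam_ops: "\<lbrakk>p \<in> ops P; set qs \<subseteq> ops P; length qs = arity P p\<rbrakk> \<Longrightarrow> gam P p qs \<in> ops P"
    and arity_gam: "\<lbrakk>p \<in> ops P; set qs \<subseteq> ops P; length qs = arity P p\<rbrakk>
      \<Longrightarrow> arity P (gam P p qs) = sum_list (map (arity P) qs)"
    and gam_one_left: "p \<in> ops P \<Longrightarrow> gam P (one P) [p] = p"
    and gam_one_right: "p \<in> ops P \<Longrightarrow> gam P p (replicate (arity P p) (one P)) = p"
    and gam_assoc: "\<lbrakk>p \<in> ops P; set qs \<subseteq> ops P; \<Union> (set (map set rss)) \<subseteq> ops P;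
        length qs = arity P p; map length rss = map (arity P) qs\<rbrakk>
      \<Longrightarrow> gam P (gam P p qs) (concat rss) = gam P p (map2 (gam P) qs rss)"
    and act_ops: "\<lbrakk>p \<in> ops P; \<sigma> permutes {1..arity P p}\<rbrakk> \<Longrightarrow> act P \<sigma> p \<in> ops P"
    and arity_act: "\<lbrakk>p \<in> ops P; \<sigma> permutes {1..arity P p}\<rbrakk> \<Longrightarrow> arity P (act P \<sigma> p) = arity P p"
    and act_id: "p \<in> ops P \<Longrightarrow> act P id p = p"
    and act_act: "\<lbrakk>p \<in> ops P; \<sigma> permutes {1..arity P p}; \<tau> permutes {1..arity P p}\<rbrakk>
      \<Longrightarrow> act P \<tau> (act P \<sigma> p) = act P (\<tau> \<circ> \<sigma>) p"
    and equivariance_inner: "\<lbrakk>p \<in> ops P; set qs \<subseteq> ops P; length qs = arity P p;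
        length \<sigma>s = length qs;
        \<And>i. i \<in> {1..length qs} \<Longrightarrow> (\<sigma>s ! (i - 1)) permutes {1..arity P (qs ! (i - 1))};
        \<tau> permutes {1..sum_list (map (arity P) qs)};
        \<And>i k. \<lbrakk>i \<in> {1..length qs}; k \<in> {1..arity P (qs ! (i - 1))}\<rbrakk>
          \<Longrightarrow> \<tau> (offset P qs i + k) = offset P qs i + (\<sigma>s ! (i - 1)) k\<rbrakk>
      \<Longrightarrow> gam P p (map2 (act P) \<sigma>s qs) = act P \<tau> (gam P p qs)"
    and equivariance_outer: "\<lbrakk>p \<in> ops P; set qs \<subseteq> ops P; length qs = arity P p;
        \<sigma> permutes {1..arity P p};
        qs' = map (\<lambda>i. qs ! (\<sigma> i - 1)) [1..<Suc (arity P p)];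
        \<tau> permutes {1..sum_list (map (arity P) qs)};
        \<And>i k. \<lbrakk>i \<in> {1..arity P p}; k \<in> {1..arity P (qs' ! (i - 1))}\<rbrakk>
          \<Longrightarrow> \<tau> (offset P qs' i + k) = offset P qs (\<sigma> i) + k\<rbrakk>
      \<Longrightarrow> gam P (act P \<sigma> p) qs = act P \<tau> (gam P p qs')"

definition operad_hom :: "'a operad \<Rightarrow> 'b operad \<Rightarrow> ('a \<Rightarrow> 'b) \<Rightarrow> bool" where
  "operad_hom P Q \<phi> \<longleftrightarrow>
    (\<forall>p\<in>ops P. \<phi> p \<in> ops Q \<and> arity Q (\<phi> p) = arity P p) \<and>
    \<phi> (one P) = one Q \<and>
    (\<forall>p\<in>ops P. \<forall>qs. set qs \<subseteq> ops P \<and> length qs = arity P p \<longrightarrow>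
        \<phi> (gam P p qs) = gam Q (\<phi> p) (map \<phi> qs)) \<and>
    (\<forall>p\<in>ops P. \<forall>\<sigma>. \<sigma> permutes {1..arity P p} \<longrightarrow> \<phi> (act P \<sigma> p) = act Q \<sigma> (\<phi> p))"

text \<open>The unique operation of arity \<open>n\<close> is represented by the number \<open>n\<close> itself.\<close>

definition uCom :: "nat operad" where
  "uCom = \<lparr>ops = UNIV, arity = (\<lambda>n. n), one = 1, gam = (\<lambda>_ qs. sum_list qs), act = (\<lambda>_ p. p)\<rparr>"

lemma symmetric_operad_uCom: "symmetric_operad uCom"
proof
  fix p :: nat and qs :: "nat list" and rss :: "nat list list"
  assume "length qs = arity uCom p" "map length rss = map (arity uCom) qs"
  then have "length rss = length qs" by (metis length_map)
  then have "map2 (\<lambda>_. sum_list) qs rss = map sum_list rss"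
    by (induction rss qs rule: list_induct2) auto
  moreover have "sum_list (concat rss) = sum_list (map sum_list rss)"
    by (induction rss) auto
  ultimately show "gam uCom (gam uCom p qs) (concat rss) = gam uCom p (map2 (gam uCom) qs rss)"
    by (simp add: uCom_def)
next
  fix p :: nat and qs :: "nat list" and \<sigma>s :: "(nat \<Rightarrow> nat) list" and \<tau>
  assume "length \<sigma>s = length qs"
  then show "gam uCom p (map2 (act uCom) \<sigma>s qs) = act uCom \<tau> (gam uCom p qs)"
    by (simp add: uCom_def) (induction \<sigma>s qs rule: list_induct2, auto)
next
  fix p :: nat and qs qs' :: "nat list" and \<sigma> \<tau>
  assume l: "length qs = arity uCom p" and \<sigma>: "\<sigma> permutes {1..arity uCom p}"
    and qs': "qs' = map (\<lambda>i. qs ! (\<sigma> i - 1)) [1..<Suc (arity uCom p)]"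
  have "sum_list qs' = (\<Sum>i\<in>{1..p}. qs ! (\<sigma> i - 1))"
    by (simp add: qs' uCom_def sum_list_distinct_conv_sum_set atLeastLessThanSuc_atLeastAtMost
        del: upt_Suc)
  also have "\<dots> = (\<Sum>i\<in>{1..p}. qs ! (i - 1))"
    using sum.permute[OF \<sigma>, of "\<lambda>i. qs ! (i - 1)"] by (simp add: uCom_def o_def)
  also have "\<dots> = (\<Sum>i<p. qs ! i)"
    by (rule sum.reindex_bij_witness[of _ Suc "\<lambda>i. i - 1"]) auto
  also have "\<dots> = sum_list qs"
    using l by (simp add: uCom_def sum_list_sum_nth atLeast0LessThan)
  finally show "gam uCom (act uCom \<sigma> p) qs = act uCom \<tau> (gam uCom p qs')"
    by (simp add: uCom_def)
qed (auto simp: uCom_def sum_list_replicate)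

lemma uCom_terminal:
  assumes "symmetric_operad P"
  shows "operad_hom P uCom (arity P)"
    and "operad_hom P uCom \<phi> \<Longrightarrow> p \<in> ops P \<Longrightarrow> \<phi> p = arity P p"
proof -
  interpret symmetric_operad P by fact
  show "operad_hom P uCom (arity P)"
    by (auto simp: operad_hom_def uCom_def arity_one arity_gam arity_act)
  show "\<phi> p = arity P p" if "operad_hom P uCom \<phi>" "p \<in> ops P"
    using that by (auto simp: operad_hom_def uCom_def)
qed


section \<open>The twisted arrow category and the enveloping category\<close>

text \<open>A tuple \<open>(q\<^sub>0; q\<^sub>1, \<dots>, q\<^sub>n; \<lambda>)\<close>: the list of vertices is \<open>[q\<^sub>0, q\<^sub>1, \<dots>, q\<^sub>n]\<close>, so that
  \<open>q\<^sub>i\<close> is \<open>verts f ! i\<close>, and \<open>\<lambda>\<close> is made \<open>undefined\<close> outside the set of leaves so that equality of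
  tuples is equality in HOL.\<close>

record 'a tuple =
  verts :: "'a list"
  num :: "nat \<times> nat \<Rightarrow> nat"

definition leaves :: "'a operad \<Rightarrow> 'a list \<Rightarrow> (nat \<times> nat) set" where
  "leaves P qs = {(i, k). 1 \<le> i \<and> i < length qs \<and> 1 \<le> k \<and> k \<le> arity P (qs ! i)}
     \<union> {(0, k) |k. 2 \<le> k \<and> k \<le> arity P (qs ! 0)}"

definition tuples :: "'a operad \<Rightarrow> nat \<Rightarrow> nat \<Rightarrow> 'a tuple set" where
  "tuples P n N = {f. length (verts f) = Suc n \<and> set (verts f) \<subseteq> ops P \<and>
     1 \<le> arity P (verts f ! 0) \<and>
     num f \<in> extensional (leaves P (verts f)) \<and>
     bij_betw (num f) (leaves P (verts f)) {1..N} \<and>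
     (\<forall>i k l. (i, k) \<in> leaves P (verts f) \<and> (i, l) \<in> leaves P (verts f) \<and> k < l
        \<longrightarrow> num f (i, k) < num f (i, l))}"

text \<open>The first input of the lower vertex is occupied by the source, so its leaves start
  at 2.\<close>

definition first_leaf :: "nat \<Rightarrow> nat" where
  "first_leaf i = (if i = 0 then 2 else 1)"

definition leaf_inputs :: "'a operad \<Rightarrow> 'a list \<Rightarrow> nat \<Rightarrow> nat list" where
  "leaf_inputs P qs i = [first_leaf i..<Suc (arity P (qs ! i))]"

text \<open>The leaves in planar order, which is the order of the inputs of the composite
  \<open>q\<^sub>0(p(q\<^sub>1, \<dots>, q\<^sub>n), id, \<dots>, id)\<close>.\<close>

definition planar_leaves :: "'a operad \<Rightarrow> 'a list \<Rightarrow> (nat \<times> nat) list" where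
  "planar_leaves P qs = concat (map (\<lambda>i. map (Pair i) (leaf_inputs P qs i)) ([1..<length qs] @ [0]))"

lemma set_planar_leaves: "set (planar_leaves P qs) = leaves P qs"
  unfolding set_eq_iff
  by (force simp: planar_leaves_def leaf_inputs_def first_leaf_def leaves_def image_iff
      simp del: upt_Suc split: if_splits)

definition labels :: "'a operad \<Rightarrow> 'a tuple \<Rightarrow> nat \<Rightarrow> nat list" where
  "labels P f i = map (\<lambda>k. num f (i, k)) (leaf_inputs P (verts f) i)"

definition list_perm :: "nat list \<Rightarrow> nat \<Rightarrow> nat" where
  "list_perm xs j = (if j \<in> {1..length xs} then xs ! (j - 1) else j)"

text \<open>\<open>graft P q p rs\<close> is \<open>q(p(rs), id, \<dots>, id)\<close>.\<close>

definition graft :: "'a operad \<Rightarrow> 'a \<Rightarrow> 'a \<Rightarrow> 'a list \<Rightarrow> 'a" where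
  "graft P q p rs = gam P q (gam P p rs # replicate (arity P q - 1) (one P))"

definition tuple_target :: "'a operad \<Rightarrow> 'a \<Rightarrow> 'a tuple \<Rightarrow> 'a" where
  "tuple_target P p f = act P (list_perm (map (num f) (planar_leaves P (verts f))))
     (graft P (verts f ! 0) p (tl (verts f)))"

definition tuple_id :: "'a operad \<Rightarrow> nat \<Rightarrow> 'a tuple" where
  "tuple_id P n = \<lparr>verts = replicate (Suc n) (one P),
     num = (\<lambda>(i, k)\<in>{1..n} \<times> {1}. i)\<rparr>"

text \<open>Composite of \<open>f = (q\<^sub>0; q\<^sub>1, \<dots>, q\<^sub>n; \<lambda>)\<close> followed by \<open>g = (r\<^sub>0; r\<^sub>1, \<dots>, r\<^sub>N; \<mu>)\<close>.
  \<open>comp_word P f g i\<close> lists the \<open>\<mu>\<close>-numbers of the leaves of the \<open>i\<close>-th composite vertex in their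
  original order. Permuting the inputs so that the numbers increase sends the input labelled \<open>x\<close> to the
  position given by the rank of \<open>x\<close>.\<close>

definition comp_word :: "'a operad \<Rightarrow> 'a tuple \<Rightarrow> 'a tuple \<Rightarrow> nat \<Rightarrow> nat list" where
  "comp_word P f g i = concat (map (labels P g) (labels P f i)) @ (if i = 0 then labels P g 0 else [])"

definition ranks :: "nat list \<Rightarrow> nat list" where
  "ranks xs = map (\<lambda>x. card {y \<in> set xs. y \<le> x}) xs"

definition comp_upper :: "'a operad \<Rightarrow> 'a tuple \<Rightarrow> 'a tuple \<Rightarrow> nat \<Rightarrow> 'a" where
  "comp_upper P f g i = act P (list_perm (ranks (comp_word P f g i)))
     (gam P (verts f ! i) (map (\<lambda>j. verts g ! j) (labels P f i)))"

definition comp_lower :: "'a operad \<Rightarrow> 'a tuple \<Rightarrow> 'a tuple \<Rightarrow> 'a" where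
  "comp_lower P f g = act P (list_perm (1 # map Suc (ranks (comp_word P f g 0))))
     (graft P (verts g ! 0) (verts f ! 0) (one P # map (\<lambda>j. verts g ! j) (labels P f 0)))"

definition tuple_comp :: "'a operad \<Rightarrow> 'a tuple \<Rightarrow> 'a tuple \<Rightarrow> 'a tuple" where
  "tuple_comp P g f =
    (let us = comp_lower P f g # map (comp_upper P f g) [1..<length (verts f)]
     in \<lparr>verts = us,
         num = (\<lambda>(i, k)\<in>leaves P us. sort (comp_word P f g i) ! (k - first_leaf i))\<rparr>)"

definition Tw_sOp :: "'a operad \<Rightarrow> ('a, 'a tuple) cat" where
  "Tw_sOp P = \<lparr>Obj = ops P,
     Hom = (\<lambda>p t. {f \<in> tuples P (arity P p) (arity P t). tuple_target P p f = t}),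
     Id = (\<lambda>p. tuple_id P (arity P p)),
     Comp = (\<lambda>_ _ _ g f. tuple_comp P g f)\<rparr>"

definition U_sOp :: "'a operad \<Rightarrow> (nat, 'a tuple) cat" where
  "U_sOp P = \<lparr>Obj = UNIV, Hom = tuples P, Id = tuple_id P,
     Comp = (\<lambda>_ _ _ g f. tuple_comp P g f)\<rparr>"

end

theory Submission
  imports Defs
begin

text \<open>A tuple \<open>(q\<^sub>0; q\<^sub>1, \<dots>, q\<^sub>n; \<lambda>)\<close> over \<open>uCom\<close> carries no information in its vertices beyond
  their arities, so it amounts to recording at which vertex each of the \<open>N\<close> numbered leaves sits:
  since the numbers increase along each vertex, the distribution of the leaves determines \<open>\<lambda>\<close>.
  Sending a leaf to its vertex, and the base point \<open>0\<close> to the lower vertex \<open>0\<close>, is a pointed map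
  \<open>{0..N} \<rightarrow> {0..n}\<close>, and every pointed map arises this way; the first input of the lower
  vertex, to which the source is attached, plays the part of the base point of the fibre over \<open>0\<close>.

  To compose two tuples is to glue the \<open>j\<close>-th upper vertex of the second one onto the leaf numbered
  \<open>j\<close> of the first one, and to glue the lower vertices together. Hence a leaf at vertex \<open>j\<close> of the
  second tuple ends up at the vertex of the first tuple that holds leaf \<open>j\<close>, which is
  composition of pointed maps in the reverse order: this is where the opposite category in the
  definition of \<open>\<Gamma>\<close> comes from. Lemmas \<open>tuple_of_map_of_tuple\<close> and \<open>map_of_tuple_of_map\<close> give the
  bijection, lemmas \<open>tuple_id_eq\<close> and \<open>tuple_comp_eq\<close> its compatibility with the category
  structure.

  Finally, an operation of \<open>uCom\<close> is its arity, so the target operation of a tuple is forced by the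
  number of its leaves, and \<open>Tw_sOp uCom\<close> and \<open>U_sOp uCom\<close> are the same category.\<close>

section \<open>Transport of the category structure along bijections\<close>

text \<open>The category laws of \<open>C\<close> are inherited from those of \<open>D\<close>, because every morphism of \<open>C\<close> is of the form \<open>Gm a b h\<close>.\<close>

lemma isomorphic_categoriesI:
  assumes D: "category D"
    and Fo: "\<And>a. a \<in> Obj C \<Longrightarrow> Fo a \<in> Obj D" "\<And>a. a \<in> Obj C \<Longrightarrow> Go (Fo a) = a"
    and Go: "\<And>x. x \<in> Obj D \<Longrightarrow> Go x \<in> Obj C" "\<And>x. x \<in> Obj D \<Longrightarrow> Fo (Go x) = x"
    and Fm: "\<And>a b f. \<lbrakk>a \<in> Obj C; b \<in> Obj C; f \<in> Hom C a b\<rbrakk> \<Longrightarrow> Fm a b f \<in> Hom D (Fo a) (Fo b)"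
      "\<And>a b f. \<lbrakk>a \<in> Obj C; b \<in> Obj C; f \<in> Hom C a b\<rbrakk> \<Longrightarrow> Gm a b (Fm a b f) = f"
    and Gm: "\<And>a b h. \<lbrakk>a \<in> Obj C; b \<in> Obj C; h \<in> Hom D (Fo a) (Fo b)\<rbrakk> \<Longrightarrow> Gm a b h \<in> Hom C a b"
      "\<And>a b h. \<lbrakk>a \<in> Obj C; b \<in> Obj C; h \<in> Hom D (Fo a) (Fo b)\<rbrakk> \<Longrightarrow> Fm a b (Gm a b h) = h"
    and Id: "\<And>a. a \<in> Obj C \<Longrightarrow> Id C a = Gm a a (Id D (Fo a))"
    and Comp: "\<And>a b c f g. \<lbrakk>a \<in> Obj C; b \<in> Obj C; c \<in> Obj C; f \<in> Hom C a b; g \<in> Hom C b c\<rbrakk>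
      \<Longrightarrow> Comp C a b c g f = Gm a c (Comp D (Fo a) (Fo b) (Fo c) (Fm b c g) (Fm a b f))"
  shows "isomorphic_categories C D"
proof -
  have IdD: "Id D x \<in> Hom D x x" if "x \<in> Obj D" for x
    using D that by (simp add: category_def)
  have CompD: "Comp D x y z g f \<in> Hom D x z"
    if "x \<in> Obj D" "y \<in> Obj D" "z \<in> Obj D" "f \<in> Hom D x y" "g \<in> Hom D y z" for x y z f g
    using D that by (simp add: category_def)
  have unitD: "Comp D x x y f (Id D x) = f" "Comp D x y y (Id D y) f = f"
    if "x \<in> Obj D" "y \<in> Obj D" "f \<in> Hom D x y" for x y f
    using D that by (simp_all add: category_def)
  have assocD: "Comp D w y z h (Comp D w x y g f) = Comp D w x z (Comp D x y z h g) f"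
    if "w \<in> Obj D" "x \<in> Obj D" "y \<in> Obj D" "z \<in> Obj D"
      "f \<in> Hom D w x" "g \<in> Hom D x y" "h \<in> Hom D y z" for w x y z f g h
    using D that unfolding category_def by blast
  have catC: "category C"
    unfolding category_def
    by (intro conjI ballI) (simp_all add: Id Comp Fo Fm Gm IdD CompD unitD assocD)
  have F: "is_functor C D Fo Fm"
    unfolding is_functor_def
    by (intro conjI ballI) (simp_all add: Id Comp Fo Fm Gm IdD CompD)
  have G: "is_functor D C Go (\<lambda>x y. Gm (Go x) (Go y))"
    unfolding is_functor_def
    by (intro conjI ballI) (simp_all add: Id Comp Fo Go Fm Gm IdD CompD)
  show ?thesis
    unfolding isomorphic_categories_def
    by (intro conjI D catC exI[of _ Fo] exI[of _ Fm] exI[of _ Go]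
          exI[of _ "\<lambda>x y. Gm (Go x) (Go y)"] F G) (simp_all add: Fo Go Fm Gm)
qed

lemma category_opposite:
  assumes "category C"
  shows "category (opposite C)"
  using assms unfolding category_def opposite_def by simp

lemma category_full_subcategory:
  assumes "category C" and "S \<subseteq> Obj C"
  shows "category (full_subcategory C S)"
  using assms unfolding category_def full_subcategory_def by (simp add: subset_iff)

lemma category_Gamma: "category Gamma"
  unfolding Gamma_def
  by (intro category_full_subcategory category_opposite category_FinSet_pt)
    (auto simp: opposite_def FinSet_pt_def)


section \<open>The labels of a tuple\<close>

lemma mem_leaves_iff:
  assumes "qs \<noteq> []"
  shows "(i, k) \<in> leaves P qs \<longleftrightarrow> i < length qs \<and> first_leaf i \<le> k \<and> k \<le> arity P (qs ! i)"
  using assms by (auto simp: leaves_def first_leaf_def)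

lemma length_labels: "length (labels P f i) = Suc (arity P (verts f ! i)) - first_leaf i"
  by (simp add: labels_def leaf_inputs_def del: upt_Suc)

lemma nth_labels:
  assumes "j < length (labels P f i)"
  shows "labels P f i ! j = num f (i, first_leaf i + j)"
  using assms unfolding length_labels by (simp add: labels_def leaf_inputs_def del: upt_Suc)

lemma set_labels:
  assumes "i < length (verts f)"
  shows "set (labels P f i) = num f ` {l \<in> leaves P (verts f). fst l = i}"
proof -
  have "verts f \<noteq> []" using assms by auto
  then have "{l \<in> leaves P (verts f). fst l = i} = Pair i ` set (leaf_inputs P (verts f) i)"
    using assms by (auto simp: mem_leaves_iff leaf_inputs_def simp del: upt_Suc)
  then show ?thesis by (simp add: labels_def image_image del: upt_Suc)
qed

text \<open>Over \<open>uCom\<close> the vertices can be read off from the numbers of labels, so a tuple is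
  nothing but its labels. The arity of the lower vertex is one more than its number of labels,
  which is why it has to be positive here.\<close>

lemma tuple_eqI:
  assumes "length (verts f) = length (verts g)" and "verts f \<noteq> []"
    and "1 \<le> verts f ! 0" "1 \<le> verts g ! 0"
    and "num f \<in> extensional (leaves uCom (verts f))"
      "num g \<in> extensional (leaves uCom (verts g))"
    and labels: "\<And>i. i < length (verts f) \<Longrightarrow> labels uCom f i = labels uCom g i"
  shows "f = (g :: nat tuple)"
proof -
  have "verts f ! i = verts g ! i" if "i < length (verts f)" for i
    using arg_cong[OF labels[OF that], of length] assms(3,4)
    by (auto simp: length_labels first_leaf_def uCom_def split: if_splits)
  then have verts: "verts f = verts g"
    using assms(1) by (intro nth_equalityI) auto
  have "num f = num g"
  proof (rule extensionalityI)
    show "num g \<in> extensional (leaves uCom (verts f))" using assms(6) verts by simp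
    fix l assume l: "l \<in> leaves uCom (verts f)"
    obtain i k where ik: "l = (i, k)" by (cases l)
    have *: "i < length (verts f)" "first_leaf i \<le> k" "k \<le> verts f ! i"
      using l assms(2) by (auto simp: ik mem_leaves_iff uCom_def)
    then have "num h l = labels uCom h i ! (k - first_leaf i)"
      if "verts h = verts f" for h :: "nat tuple"
      using that by (subst nth_labels) (auto simp: length_labels uCom_def ik)
    then show "num f l = num g l"
      using labels[OF *(1)] verts by simp
  qed fact
  with verts show ?thesis by simp
qed

text \<open>Used for gluing vertices: several vertices may have no leaves at all, so the lists \<open>h x\<close> need
  not be pairwise different, as \<open>distinct_concat\<close> would demand.\<close>

lemma distinct_concat_map:
  assumes "distinct xs" and "\<And>x. x \<in> set xs \<Longrightarrow> distinct (h x)"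
    and "\<And>x y. \<lbrakk>x \<in> set xs; y \<in> set xs; x \<noteq> y\<rbrakk> \<Longrightarrow> set (h x) \<inter> set (h y) = {}"
  shows "distinct (concat (map h xs))"
  using assms
proof (induction xs)
  case (Cons x xs)
  then have "distinct (concat (map h xs))" by simp
  moreover have "set (h x) \<inter> (\<Union>y\<in>set xs. set (h y)) = {}"
    using Cons.prems by fastforce
  ultimately show ?case using Cons.prems by simp
qed simp

lemma sort_eq_sorted_list_of_set: "distinct xs \<Longrightarrow> sort xs = sorted_list_of_set (set xs)"
  by (simp add: sorted_list_of_set_sort_remdups distinct_remdups_id)


section \<open>Tuples and pointed maps\<close>

definition pointed_maps :: "nat \<Rightarrow> nat \<Rightarrow> (nat \<Rightarrow> nat) set" where
  "pointed_maps N n = {h \<in> {0..N} \<rightarrow>\<^sub>E {0..n}. h 0 = 0}"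

text \<open>The base point is left out of the fibre over \<open>0\<close>: it stands for the first input of the lower
  vertex, which is not a leaf.\<close>

definition fibre :: "nat \<Rightarrow> (nat \<Rightarrow> nat) \<Rightarrow> nat \<Rightarrow> nat set" where
  "fibre N h i = {x \<in> {1..N}. h x = i}"

definition tuple_of_map :: "nat \<Rightarrow> nat \<Rightarrow> (nat \<Rightarrow> nat) \<Rightarrow> nat tuple" where
  "tuple_of_map n N h =
    (let qs = map (\<lambda>i. card (fibre N h i) + (if i = 0 then 1 else 0)) [0..<Suc n]
     in \<lparr>verts = qs,
         num = (\<lambda>(i, k)\<in>leaves uCom qs. sorted_list_of_set (fibre N h i) ! (k - first_leaf i))\<rparr>)"

definition map_of_tuple :: "nat \<Rightarrow> nat tuple \<Rightarrow> nat \<Rightarrow> nat" where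
  "map_of_tuple N f =
    (\<lambda>x\<in>{0..N}. if x = 0 then 0 else fst (inv_into (leaves uCom (verts f)) (num f) x))"

lemma finite_fibre [simp]: "finite (fibre N h i)"
  by (simp add: fibre_def)

lemma length_verts_tuple_of_map: "length (verts (tuple_of_map n N h)) = Suc n"
  by (simp add: tuple_of_map_def Let_def del: upt_Suc)

lemma verts_tuple_of_map:
  "i \<le> n \<Longrightarrow> verts (tuple_of_map n N h) ! i = card (fibre N h i) + (if i = 0 then 1 else 0)"
  by (simp add: tuple_of_map_def Let_def less_Suc_eq_le del: upt_Suc)

lemma num_tuple_of_map_extensional:
  "num (tuple_of_map n N h) \<in> extensional (leaves uCom (verts (tuple_of_map n N h)))"
  by (simp add: tuple_of_map_def Let_def del: upt_Suc)

lemma mem_leaves_tuple_of_map: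
  "(i, k) \<in> leaves uCom (verts (tuple_of_map n N h)) \<longleftrightarrow>
    i \<le> n \<and> first_leaf i \<le> k \<and> k - first_leaf i < card (fibre N h i)"
proof -
  have "verts (tuple_of_map n N h) \<noteq> []"
    using length_verts_tuple_of_map[of n N h] by auto
  then show ?thesis
    by (auto simp: mem_leaves_iff length_verts_tuple_of_map verts_tuple_of_map uCom_def
        less_Suc_eq_le first_leaf_def)
qed

lemma num_tuple_of_map:
  "(i, k) \<in> leaves uCom (verts (tuple_of_map n N h)) \<Longrightarrow>
    num (tuple_of_map n N h) (i, k) = sorted_list_of_set (fibre N h i) ! (k - first_leaf i)"
  by (simp add: tuple_of_map_def Let_def del: upt_Suc)

lemma labels_tuple_of_map:
  assumes "i \<le> n"
  shows "labels uCom (tuple_of_map n N h) i = sorted_list_of_set (fibre N h i)"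
proof (rule nth_equalityI)
  show len: "length (labels uCom (tuple_of_map n N h) i) = length (sorted_list_of_set (fibre N h i))"
    using assms by (simp add: length_labels verts_tuple_of_map uCom_def first_leaf_def)
  fix j assume j: "j < length (labels uCom (tuple_of_map n N h) i)"
  then have "(i, first_leaf i + j) \<in> leaves uCom (verts (tuple_of_map n N h))"
    using assms len by (simp add: mem_leaves_tuple_of_map)
  then show "labels uCom (tuple_of_map n N h) i ! j = sorted_list_of_set (fibre N h i) ! j"
    using j by (simp add: nth_labels num_tuple_of_map)
qed

lemma tuple_eq_tuple_of_mapI:
  assumes "length (verts f) = Suc n" "1 \<le> verts f ! 0"
    and "num f \<in> extensional (leaves uCom (verts f))"
    and "\<And>i. i \<le> n \<Longrightarrow> labels uCom f i = sorted_list_of_set (fibre N h i)"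
  shows "f = tuple_of_map n N h"
proof (rule tuple_eqI)
  show "verts f \<noteq> []" using assms(1) by auto
qed (use assms in \<open>simp_all add: length_verts_tuple_of_map verts_tuple_of_map
      num_tuple_of_map_extensional labels_tuple_of_map\<close>)

lemma tuple_of_map_in_tuples:
  assumes h: "h \<in> pointed_maps N n"
  shows "tuple_of_map n N h \<in> tuples uCom n N"
proof -
  let ?f = "tuple_of_map n N h"
  let ?L = "leaves uCom (verts ?f)"
  let ?s = "\<lambda>i. sorted_list_of_set (fibre N h i)"
  have in_fibre: "num ?f (i, k) \<in> fibre N h i" if "(i, k) \<in> ?L" for i k
    using that nth_mem[of "k - first_leaf i" "?s i"]
    by (simp add: num_tuple_of_map mem_leaves_tuple_of_map)
  have mono: "num ?f (i, k) < num ?f (i, l)"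
    if "(i, k) \<in> ?L" "(i, l) \<in> ?L" "k < l" for i k l
    using that sorted_wrt_nth_less[OF strict_sorted_list_of_set, of "k - first_leaf i"
        "l - first_leaf i" "fibre N h i"]
    by (auto simp: num_tuple_of_map mem_leaves_tuple_of_map)
  have "bij_betw (num ?f) ?L {1..N}"
  proof (rule bij_betwI')
    fix l l' assume l: "l \<in> ?L" "l' \<in> ?L"
    obtain i k i' k' where ik: "l = (i, k)" "l' = (i', k')" by (cases l, cases l')
    show "(num ?f l = num ?f l') = (l = l')"
    proof
      assume eq: "num ?f l = num ?f l'"
      then have "i = i'"
        using in_fibre[of i k] in_fibre[of i' k'] l by (auto simp: ik fibre_def)
      moreover from this have "k = k'"
        using mono[of i k k'] mono[of i k' k] l eq by (cases k k' rule: linorder_cases) (auto simp: ik)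
      ultimately show "l = l'" by (simp add: ik)
    qed simp
  next
    show "num ?f l \<in> {1..N}" if "l \<in> ?L" for l
      using in_fibre[of "fst l" "snd l"] that by (auto simp: fibre_def)
  next
    fix x assume x: "x \<in> {1..N}"
    then have "x \<in> set (labels uCom ?f (h x))" and "h x \<le> n"
      using h by (auto simp: pointed_maps_def labels_tuple_of_map fibre_def PiE_def Pi_def)
    then show "\<exists>l\<in>?L. x = num ?f l"
      by (subst (asm) set_labels) (auto simp: length_verts_tuple_of_map)
  qed
  then show ?thesis
    using mono num_tuple_of_map_extensional[of n N h]
    by (auto simp: tuples_def length_verts_tuple_of_map verts_tuple_of_map) (simp_all add: uCom_def)
qed

lemma map_of_tuple_num:
  assumes "f \<in> tuples uCom n N" and "l \<in> leaves uCom (verts f)"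
  shows "map_of_tuple N f (num f l) = fst l"
proof -
  have b: "bij_betw (num f) (leaves uCom (verts f)) {1..N}"
    using assms(1) by (simp add: tuples_def)
  then have "num f l \<in> {1..N}" using assms(2) by (rule bij_betwE[rule_format])
  then show ?thesis
    using bij_betw_inv_into_left[OF b assms(2)] by (simp add: map_of_tuple_def)
qed

lemma map_of_tuple_in_pointed_maps:
  assumes f: "f \<in> tuples uCom n N"
  shows "map_of_tuple N f \<in> pointed_maps N n"
proof -
  have "map_of_tuple N f x \<in> {0..n}" if "x \<in> {1..N}" for x
  proof -
    have "num f ` leaves uCom (verts f) = {1..N}" and len: "length (verts f) = Suc n"
      using f by (simp_all add: tuples_def bij_betw_def)
    then have "x \<in> num f ` leaves uCom (verts f)" using that by simp
    then obtain l where l: "x = num f l" "l \<in> leaves uCom (verts f)" by (rule imageE)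
    have "fst l < length (verts f)" using l(2) len by (auto simp: leaves_def)
    then show ?thesis using map_of_tuple_num[OF f l(2)] l(1) len by simp
  qed
  moreover have "map_of_tuple N f 0 = 0" by (simp add: map_of_tuple_def)
  ultimately have "map_of_tuple N f x \<in> {0..n}" if "x \<in> {0..N}" for x
    using that by (cases "x = 0") simp_all
  then show ?thesis
    by (simp add: pointed_maps_def PiE_def map_of_tuple_def)
qed

lemma labels_eq_fibre:
  assumes f: "f \<in> tuples uCom n N" and i: "i \<le> n"
  shows "labels uCom f i = sorted_list_of_set (fibre N (map_of_tuple N f) i)"
proof -
  let ?L = "leaves uCom (verts f)"
  have len: "length (verts f) = Suc n" and b: "num f ` ?L = {1..N}"
    and mono: "\<And>i k l. (i, k) \<in> ?L \<Longrightarrow> (i, l) \<in> ?L \<Longrightarrow> k < l \<Longrightarrow> num f (i, k) < num f (i, l)"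
    using f by (auto simp: tuples_def bij_betw_def)
  have ne: "verts f \<noteq> []" using len by auto
  have "sorted_wrt (<) (labels uCom f i)"
    unfolding sorted_wrt_iff_nth_less
    using i len ne by (auto simp: nth_labels length_labels mem_leaves_iff intro!: mono)
  moreover have "set (labels uCom f i) = fibre N (map_of_tuple N f) i"
  proof -
    have "fibre N (map_of_tuple N f) i = {x \<in> num f ` ?L. map_of_tuple N f x = i}"
      by (simp add: fibre_def b)
    also have "\<dots> = num f ` {l \<in> ?L. fst l = i}"
      using map_of_tuple_num[OF f] by auto
    finally show ?thesis using set_labels[of i f uCom] i len by simp
  qed
  ultimately show ?thesis
    by (metis sorted_list_of_set.idem_if_sorted_distinct strict_sorted_iff)
qed

lemma tuple_of_map_of_tuple:
  assumes "f \<in> tuples uCom n N"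
  shows "tuple_of_map n N (map_of_tuple N f) = f"
  using assms labels_eq_fibre[OF assms]
  by (intro tuple_eq_tuple_of_mapI[symmetric]) (auto simp: tuples_def uCom_def)

lemma map_of_tuple_of_map:
  assumes h: "h \<in> pointed_maps N n"
  shows "map_of_tuple N (tuple_of_map n N h) = h" (is "?h = h")
proof -
  have t: "tuple_of_map n N h \<in> tuples uCom n N" by (rule tuple_of_map_in_tuples[OF h])
  have h': "?h \<in> pointed_maps N n" by (rule map_of_tuple_in_pointed_maps[OF t])
  show ?thesis
  proof (rule extensionalityI)
    fix x assume x: "x \<in> {0..N}"
    have "h x \<le> n" using h x by (auto simp: pointed_maps_def PiE_def Pi_def)
    then have "fibre N ?h (h x) = fibre N h (h x)"
      using labels_eq_fibre[OF t] labels_tuple_of_map[of "h x" n N h]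
      by (metis finite_fibre sorted_list_of_set.set_sorted_key_list_of_set)
    then show "?h x = h x"
      using x h h' by (cases "x = 0") (auto simp: fibre_def pointed_maps_def)
  qed (use h h' in \<open>auto simp: pointed_maps_def PiE_def\<close>)
qed


section \<open>Identities and composites\<close>

lemma tuple_id_eq: "tuple_id uCom n = tuple_of_map n n (restrict id {0..n})"
proof (rule tuple_eq_tuple_of_mapI)
  let ?f = "tuple_id uCom n :: nat tuple"
  have L: "leaves uCom (verts ?f) = {1..n} \<times> {1}"
    by (auto simp: tuple_id_def leaves_def uCom_def nth_Cons' simp del: replicate_Suc)
  show "num ?f \<in> extensional (leaves uCom (verts ?f))"
    unfolding L by (simp add: tuple_id_def)
  fix i assume i: "i \<le> n"
  show "labels uCom ?f i = sorted_list_of_set (fibre n (restrict id {0..n}) i)"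
  proof (cases "i = 0")
    case True
    then have "fibre n (restrict id {0..n}) i = {}" by (auto simp: fibre_def)
    with True show ?thesis
      by (simp add: labels_def leaf_inputs_def first_leaf_def tuple_id_def uCom_def)
  next
    case False
    then have "fibre n (restrict id {0..n}) i = {i}" using i by (auto simp: fibre_def)
    moreover have "verts ?f ! i = 1"
      using i by (simp add: tuple_id_def uCom_def less_Suc_eq_le del: replicate_Suc)
    moreover have "num ?f (i, 1) = i" using i False by (simp add: tuple_id_def)
    ultimately show ?thesis
      using False by (simp add: labels_def leaf_inputs_def first_leaf_def uCom_def)
  qed
qed (simp_all add: tuple_id_def uCom_def)

text \<open>The inputs of the composite vertex \<open>i\<close> carry the labels that the second tuple has at the
  vertices glued onto \<open>i\<close>, namely those whose numbers label \<open>i\<close>, together with its lower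
  vertex if \<open>i = 0\<close>. The latter agrees with the composite map because \<open>0\<close> is sent to \<open>0\<close>.\<close>

lemma sort_comp_word:
  assumes f: "f \<in> tuples uCom n N" and g: "g \<in> tuples uCom N M" and i: "i \<le> n"
  shows "sort (comp_word uCom f g i) =
      sorted_list_of_set (fibre M (compose {0..M} (map_of_tuple N f) (map_of_tuple M g)) i)"
proof -
  let ?F = "map_of_tuple N f" and ?G = "map_of_tuple M g"
  have lf: "labels uCom f i = sorted_list_of_set (fibre N ?F i)" by (rule labels_eq_fibre[OF f i])
  have lg: "labels uCom g j = sorted_list_of_set (fibre M ?G j)" if "j \<le> N" for j
    by (rule labels_eq_fibre[OF g that])
  have G: "?G x \<le> N" if "x \<le> M" for x
    using map_of_tuple_in_pointed_maps[OF g] that by (auto simp: pointed_maps_def PiE_def Pi_def)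
  have F0: "?F 0 = 0" by (simp add: map_of_tuple_def)
  have sub: "1 \<le> j \<and> j \<le> N" if "j \<in> fibre N ?F i" for j
    using that by (auto simp: fibre_def)
  have "distinct (concat (map (labels uCom g) (labels uCom f i)))"
  proof (rule distinct_concat_map)
    show "set (labels uCom g j) \<inter> set (labels uCom g j') = {}"
      if "j \<in> set (labels uCom f i)" "j' \<in> set (labels uCom f i)" "j \<noteq> j'" for j j'
      using that by (auto simp: lf lg sub) (auto simp: fibre_def)
  qed (auto simp: lf lg sub)
  moreover have "set (concat (map (labels uCom g) (labels uCom f i))) \<inter> set (labels uCom g 0) = {}"
    by (auto simp: lf lg sub) (auto simp: fibre_def)
  ultimately have d: "distinct (comp_word uCom f g i)"
    by (auto simp: comp_word_def lg)
  have "set (comp_word uCom f g i) =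
      (\<Union>j\<in>fibre N ?F i. fibre M ?G j) \<union> (if i = 0 then fibre M ?G 0 else {})"
    by (simp add: comp_word_def lf lg sub)
  also have "\<dots> = fibre M (compose {0..M} ?F ?G) i"
  proof -
    \<comment> \<open>A leaf at the lower vertex of the second tuple has \<open>?G x = 0\<close>, which labels no vertex.\<close>
    have "?F (?G x) = i \<longleftrightarrow> ?G x \<in> fibre N ?F i \<or> i = 0 \<and> ?G x = 0" if "x \<le> M" for x
      using F0 G[OF that] by (cases "?G x = 0") (auto simp: fibre_def)
    then show ?thesis
      by (auto simp: fibre_def[of M] compose_def split: if_splits)
  qed
  finally show "sort (comp_word uCom f g i) = sorted_list_of_set (fibre M (compose {0..M} ?F ?G) i)"
    by (simp add: sort_eq_sorted_list_of_set[OF d])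
qed

text \<open>The arity of a composite vertex, an operadic composite in \<open>uCom\<close>, is the number of its labels
  plus, for the lower vertex, the input that receives the source.\<close>

lemma arity_comp:
  assumes f: "f \<in> tuples uCom n N" and g: "g \<in> tuples uCom N M" and i: "i \<le> n"
  shows "(if i = 0 then comp_lower uCom f g else comp_upper uCom f g i) =
    length (comp_word uCom f g i) + (if i = 0 then 1 else 0)"
proof -
  have "verts g ! j = length (labels uCom g j)" if "j \<in> set (labels uCom f i)" for j
    using that labels_eq_fibre[OF f i]
    by (auto simp: length_labels first_leaf_def uCom_def fibre_def)
  then have "sum_list (map ((!) (verts g)) (labels uCom f i)) =
      length (concat (map (labels uCom g) (labels uCom f i)))"
    by (simp add: length_concat o_def cong: map_cong)
  moreover have "1 \<le> verts g ! 0" using g by (simp add: tuples_def uCom_def)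
  moreover have "length (labels uCom g 0) = verts g ! 0 - 1"
    by (simp add: length_labels first_leaf_def uCom_def)
  ultimately show ?thesis
    by (auto simp: comp_lower_def comp_upper_def comp_word_def graft_def uCom_def
        sum_list_replicate)
qed

lemma tuple_comp_eq:
  assumes f: "f \<in> tuples uCom n N" and g: "g \<in> tuples uCom N M"
  shows "tuple_comp uCom g f =
    tuple_of_map n M (compose {0..M} (map_of_tuple N f) (map_of_tuple M g))"
proof (rule tuple_eq_tuple_of_mapI)
  let ?c = "tuple_comp uCom g f"
  have len_f: "length (verts f) = Suc n" using f by (simp add: tuples_def)
  show len: "length (verts ?c) = Suc n"
    by (simp add: tuple_comp_def Let_def len_f del: upt_Suc)
  have verts: "verts ?c ! i = length (comp_word uCom f g i) + (if i = 0 then 1 else 0)"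
    if "i \<le> n" for i
    using arity_comp[OF f g that] that
    by (auto simp: tuple_comp_def Let_def len_f nth_Cons' simp del: upt_Suc)
  then show "1 \<le> verts ?c ! 0" by simp
  show "num ?c \<in> extensional (leaves uCom (verts ?c))"
    by (simp add: tuple_comp_def Let_def)
  fix i assume i: "i \<le> n"
  have "labels uCom ?c i = sort (comp_word uCom f g i)"
  proof (rule nth_equalityI)
    show len': "length (labels uCom ?c i) = length (sort (comp_word uCom f g i))"
      using verts[OF i] by (simp add: length_labels first_leaf_def uCom_def)
    fix j assume j: "j < length (labels uCom ?c i)"
    have "verts ?c \<noteq> []" using len by auto
    then have "(i, first_leaf i + j) \<in> leaves uCom (verts ?c)"
      using j i len by (auto simp: mem_leaves_iff length_labels)
    then have "num ?c (i, first_leaf i + j) = sort (comp_word uCom f g i) ! j"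
      by (simp add: tuple_comp_def Let_def)
    then show "labels uCom ?c i ! j = sort (comp_word uCom f g i) ! j"
      using j by (simp add: nth_labels)
  qed
  then show "labels uCom ?c i =
      sorted_list_of_set (fibre M (compose {0..M} (map_of_tuple N f) (map_of_tuple M g)) i)"
    using sort_comp_word[OF f g i] by simp
qed


section \<open>The isomorphisms\<close>

lemma Obj_Gamma: "Obj Gamma = range (\<lambda>n. ({0..n}, 0))"
  by (simp add: Gamma_def full_subcategory_def)

lemma Hom_Gamma: "Hom Gamma ({0..n}, 0) ({0..N}, 0) = pointed_maps N n"
  by (simp add: Gamma_def full_subcategory_def opposite_def FinSet_pt_def pointed_maps_def)

lemma Id_Gamma: "Id Gamma ({0..n}, 0) = restrict id {0..n}"
  by (simp add: Gamma_def full_subcategory_def opposite_def FinSet_pt_def)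

lemma Comp_Gamma: "Comp Gamma a b ({0..M}, 0) g f = compose {0..M} f g"
  by (simp add: Gamma_def full_subcategory_def opposite_def FinSet_pt_def)

lemma isomorphic_U_sOp_uCom_Gamma: "isomorphic_categories (U_sOp uCom) Gamma"
  by (rule isomorphic_categoriesI[where Fo = "\<lambda>n. ({0..n}, 0)" and Go = "\<lambda>(A, a). card A - 1"
        and Fm = "\<lambda>n N. map_of_tuple N" and Gm = tuple_of_map])
    (simp_all add: category_Gamma Obj_Gamma Hom_Gamma Id_Gamma Comp_Gamma U_sOp_def
      map_of_tuple_in_pointed_maps tuple_of_map_in_tuples tuple_of_map_of_tuple
      map_of_tuple_of_map tuple_id_eq tuple_comp_eq image_iff, auto)

text \<open>The target of a tuple has as many inputs as there are leaves, and \<open>uCom\<close> has only one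
  operation with that many inputs.\<close>

lemma tuple_target_uCom:
  assumes f: "f \<in> tuples uCom n N"
  shows "tuple_target uCom n f = N"
proof -
  let ?v = "verts f"
  have len: "length ?v = Suc n" and b: "bij_betw (num f) (leaves uCom ?v) {1..N}"
    using f by (simp_all add: tuples_def uCom_def)
  have ne: "?v \<noteq> []" using len by auto
  have "leaves uCom ?v = Sigma {..n} (\<lambda>i. {first_leaf i..?v ! i})"
    using len by (auto simp: mem_leaves_iff[OF ne] uCom_def)
  then have "N = (\<Sum>i\<le>n. Suc (?v ! i) - first_leaf i)"
    using bij_betw_same_card[OF b] by simp
  also have "\<dots> = (?v ! 0 - 1) + (\<Sum>i<n. ?v ! Suc i)"
    by (simp add: sum.atMost_shift first_leaf_def)
  also have "(\<Sum>i<n. ?v ! Suc i) = sum_list (tl ?v)"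
    using len by (simp add: sum_list_sum_nth atLeast0LessThan nth_tl)
  finally show ?thesis
    by (simp add: tuple_target_def graft_def uCom_def sum_list_replicate)
qed

lemma Tw_sOp_uCom: "Tw_sOp uCom = U_sOp uCom"
proof -
  have "tuples uCom (arity uCom p) (arity uCom t) = tuples uCom p t" for p t
    by (simp add: uCom_def)
  moreover have "ops uCom = UNIV" "arity uCom p = p" for p by (simp_all add: uCom_def)
  ultimately show ?thesis
    by (auto simp: Tw_sOp_def U_sOp_def tuple_target_uCom fun_eq_iff)
qed

theorem proposition2p27:
  shows "isomorphic_categories (Tw_sOp uCom) Gamma \<and> isomorphic_categories (U_sOp uCom) Gamma"
  by (simp add: Tw_sOp_uCom isomorphic_U_sOp_uCom_Gamma)

end
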